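(* Let $(V,g)$ be a Euclidean real vector space of dimension $n$ and let $0\le p,q\le n$. The multiplication map by $g$, $D^{p,q}\to D^{p+1,q+1}$, $\omega\mapsto g\omega$, is (1) one to one if and only if $p+q\le n-1$; (2) bijective if and only if $p+q=n-1$; (3) onto if and only if $p+q\ge n-1$.
   Context: $D^{p,q}=\Lambda^pV^*\otimes\Lambda^qV^*$ (zero if $p>n$ or $q>n$), with product $(\theta_1\otimes\theta_2)\cdot(\theta_3\otimes\theta_4)=(\theta_1\wedge\theta_3)\otimes(\theta_2\wedge\theta_4)$ on $\bigoplus_{p,q}D^{p,q}$. The inner product $g$ is regarded as the element $g=\sum_{i=1}^n e_i\otimes e_i\in D^{1,1}$, for an orthonormal basis $(e_i)$ of $V^*$. *)

theory Defs
  imports "HOL-Analysis.Analysis" "HOL-Combinatorics.Transposition"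
begin

section \<open>Exterior forms\<close>

text \<open>
  \<open>\<Lambda>\<^sup>p V*\<close> is the space of alternating \<open>p\<close>-linear forms on \<open>V\<close>, where \<open>V\<close> is the type \<^typ>\<open>'a\<close>.
  A form takes the list of its arguments and is zero on lists of the wrong length, so that forms of
  different degrees live in one type and \<open>\<Lambda>\<^sup>0 V*\<close> is \<open>\<real>\<close> (the value at the empty list).
\<close>

definition alt_forms :: "nat \<Rightarrow> ('a::real_vector list \<Rightarrow> real) set" where
  "alt_forms p = {\<theta>.
     (\<forall>xs. length xs \<noteq> p \<longrightarrow> \<theta> xs = 0) \<and>
     (\<forall>xs i. length xs = p \<longrightarrow> i < p \<longrightarrow> linear (\<lambda>v. \<theta> (xs[i := v]))) \<and>
     (\<forall>xs. \<not> distinct xs \<longrightarrow> \<theta> xs = 0)}"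

text \<open>
  The sign of the shuffle that lists the positions in \<open>S\<close> first and the remaining ones afterwards,
  both in increasing order: \<open>-1\<close> to the number of inversions.
\<close>

definition shuffle_sign :: "nat set \<Rightarrow> real" where
  "shuffle_sign S = (- 1) ^ card {(i, j). i \<in> S \<and> j \<notin> S \<and> j < i}"

text \<open>
  The wedge product as a sum over shuffles. For \<open>\<alpha>\<close> of degree \<open>p\<close> and \<open>\<beta>\<close> of degree \<open>q\<close> only the
  sets \<open>S\<close> with \<open>p\<close> elements contribute, and only on lists of length \<open>p + q\<close>; this is
  \<open>1 / (p! q!)\<close> times the signed sum over all permutations.
\<close>

definition wedge ::
  "('a list \<Rightarrow> real) \<Rightarrow> ('a list \<Rightarrow> real) \<Rightarrow> 'a list \<Rightarrow> real" (infixr "\<and>\<^sub>f" 70) where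
  "(\<alpha> \<and>\<^sub>f \<beta>) xs =
     (\<Sum>S\<in>Pow {..<length xs}. shuffle_sign S * \<alpha> (nths xs S) * \<beta> (nths xs (- S)))"

section \<open>Double forms\<close>

definition tensor ::
  "('a list \<Rightarrow> real) \<Rightarrow> ('a list \<Rightarrow> real) \<Rightarrow> 'a list \<Rightarrow> 'a list \<Rightarrow> real" (infix "\<otimes>\<^sub>f" 65) where
  "(\<theta> \<otimes>\<^sub>f \<eta>) xs ys = \<theta> xs * \<eta> ys"

text \<open>
  \<open>D\<^sup>p\<^sup>,\<^sup>q = \<Lambda>\<^sup>p V* \<otimes> \<Lambda>\<^sup>q V*\<close>, realised as the finite sums of simple tensors inside the real functions
  of two argument lists (for spaces of functions this is the tensor product). It is zero when
  \<open>p\<close> or \<open>q\<close> exceeds the dimension, see \<open>double_forms_eq_zero\<close> below.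
\<close>

definition double_forms :: "nat \<Rightarrow> nat \<Rightarrow> ('a::real_vector list \<Rightarrow> 'a list \<Rightarrow> real) set" where
  "double_forms p q = {\<omega>. \<exists>(k::nat) \<theta> \<eta>.
     (\<forall>i<k. \<theta> i \<in> alt_forms p \<and> \<eta> i \<in> alt_forms q) \<and>
     \<omega> = (\<lambda>xs ys. \<Sum>i<k. (\<theta> i \<otimes>\<^sub>f \<eta> i) xs ys)}"

text \<open>
  The product of double forms: the bilinear extension of
  \<open>(\<theta>\<^sub>1 \<otimes> \<theta>\<^sub>2) \<cdot> (\<theta>\<^sub>3 \<otimes> \<theta>\<^sub>4) = (\<theta>\<^sub>1 \<and> \<theta>\<^sub>3) \<otimes> (\<theta>\<^sub>2 \<and> \<theta>\<^sub>4)\<close>, see \<open>dmult_tensor\<close> and \<open>dmult_sum\<close> below.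
\<close>

definition dmult ::
  "('a list \<Rightarrow> 'a list \<Rightarrow> real) \<Rightarrow> ('a list \<Rightarrow> 'a list \<Rightarrow> real) \<Rightarrow> 'a list \<Rightarrow> 'a list \<Rightarrow> real"
  (infixl "\<cdot>\<^sub>d" 70) where
  "(\<omega> \<cdot>\<^sub>d \<eta>) xs ys =
     (\<Sum>S\<in>Pow {..<length xs}. \<Sum>T\<in>Pow {..<length ys}.
        shuffle_sign S * shuffle_sign T *
        \<omega> (nths xs S) (nths ys T) * \<eta> (nths xs (- S)) (nths ys (- T)))"

text \<open>
  The inner product of \<open>V\<close> as a double form of bidegree \<open>(1, 1)\<close>. It equals
  \<open>\<Sum>\<^sub>i e\<^sub>i \<otimes> e\<^sub>i\<close> for the covectors \<open>e\<^sub>i\<close> dual to any orthonormal basis, see \<open>metric_form_eq_sum\<close>.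
\<close>

definition metric_form :: "'a::real_inner list \<Rightarrow> 'a list \<Rightarrow> real" where
  "metric_form xs ys = (if length xs = 1 \<and> length ys = 1 then inner (hd xs) (hd ys) else 0)"

definition covector :: "'a::real_inner \<Rightarrow> 'a list \<Rightarrow> real" where
  "covector b xs = (if length xs = 1 then inner b (hd xs) else 0)"

section \<open>Agreement with the defining properties\<close>

lemma dmult_tensor: "(\<theta>\<^sub>1 \<otimes>\<^sub>f \<theta>\<^sub>2) \<cdot>\<^sub>d (\<theta>\<^sub>3 \<otimes>\<^sub>f \<theta>\<^sub>4) = (\<theta>\<^sub>1 \<and>\<^sub>f \<theta>\<^sub>3) \<otimes>\<^sub>f (\<theta>\<^sub>2 \<and>\<^sub>f \<theta>\<^sub>4)"
  by (intro ext) (simp add: dmult_def tensor_def wedge_def sum_product mult_ac)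

lemma dmult_sum:
  fixes \<omega> \<eta> :: "_ \<Rightarrow> 'a list \<Rightarrow> 'a list \<Rightarrow> real"
  shows "(\<lambda>xs ys. \<Sum>i\<in>I. a i * \<omega> i xs ys) \<cdot>\<^sub>d (\<lambda>xs ys. \<Sum>j\<in>J. b j * \<eta> j xs ys) =
   (\<lambda>xs ys. \<Sum>i\<in>I. \<Sum>j\<in>J. a i * b j * (\<omega> i \<cdot>\<^sub>d \<eta> j) xs ys)"
proof (intro ext)
  fix xs ys :: "'a list"
  let ?A = "Pow {..<length xs}" and ?B = "Pow {..<length ys}"
  let ?t = "\<lambda>S T i j. a i * b j * (shuffle_sign S * shuffle_sign T *
        \<omega> i (nths xs S) (nths ys T) * \<eta> j (nths xs (- S)) (nths ys (- T)))"
  have "((\<lambda>xs ys. \<Sum>i\<in>I. a i * \<omega> i xs ys) \<cdot>\<^sub>d (\<lambda>xs ys. \<Sum>j\<in>J. b j * \<eta> j xs ys)) xs ys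
      = (\<Sum>S\<in>?A. \<Sum>T\<in>?B. \<Sum>i\<in>I. \<Sum>j\<in>J. ?t S T i j)"
    by (simp add: dmult_def sum_product sum_distrib_left sum_distrib_right mult_ac)
  also have "\<dots> = (\<Sum>S\<in>?A. \<Sum>i\<in>I. \<Sum>T\<in>?B. \<Sum>j\<in>J. ?t S T i j)"
    by (intro sum.cong refl sum.swap)
  also have "\<dots> = (\<Sum>i\<in>I. \<Sum>S\<in>?A. \<Sum>T\<in>?B. \<Sum>j\<in>J. ?t S T i j)"
    by (rule sum.swap)
  also have "\<dots> = (\<Sum>i\<in>I. \<Sum>S\<in>?A. \<Sum>j\<in>J. \<Sum>T\<in>?B. ?t S T i j)"
    by (intro sum.cong refl sum.swap)
  also have "\<dots> = (\<Sum>i\<in>I. \<Sum>j\<in>J. \<Sum>S\<in>?A. \<Sum>T\<in>?B. ?t S T i j)"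
    by (intro sum.cong refl sum.swap)
  also have "\<dots> = (\<Sum>i\<in>I. \<Sum>j\<in>J. a i * b j * (\<omega> i \<cdot>\<^sub>d \<eta> j) xs ys)"
    by (simp add: dmult_def sum_distrib_left)
  finally show "((\<lambda>xs ys. \<Sum>i\<in>I. a i * \<omega> i xs ys) \<cdot>\<^sub>d (\<lambda>xs ys. \<Sum>j\<in>J. b j * \<eta> j xs ys)) xs ys
      = (\<Sum>i\<in>I. \<Sum>j\<in>J. a i * b j * (\<omega> i \<cdot>\<^sub>d \<eta> j) xs ys)" .
qed

lemma covector_alt_form: "covector b \<in> alt_forms 1"
proof -
  have "length xs \<noteq> 1" if "\<not> distinct xs" for xs :: "'a list"
    using that by (auto simp: length_Suc_conv)
  then show ?thesis
    by (auto simp: alt_forms_def covector_def length_Suc_conv linear_iff inner_simps)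
qed

lemma metric_form_eq_sum:
  fixes B :: "'a::real_inner set"
  assumes "finite B" "span B = UNIV" "pairwise orthogonal B" "\<And>b. b \<in> B \<Longrightarrow> norm b = 1"
  shows "metric_form = (\<lambda>xs ys. \<Sum>b\<in>B. (covector b \<otimes>\<^sub>f covector b) xs ys)"
proof -
  have *: "inner x y = (\<Sum>b\<in>B. inner b x * inner b y)" for x y
  proof -
    have "x \<in> span B" using assms by auto
    then show ?thesis
    proof (induction rule: span_induct_alt)
      case base
      show ?case by simp
    next
      case (step c a z)
      have "(\<Sum>b\<in>B. inner b a * inner b y) = (\<Sum>b\<in>B. if b = a then inner a y else 0)"
        using assms step
        by (intro sum.cong) (auto simp: pairwise_def orthogonal_def norm_eq_1)
      also have "\<dots> = inner a y" using assms step by simp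
      finally show ?case
        by (simp add: inner_simps step.IH algebra_simps sum.distrib flip: sum_distrib_left)
    qed
  qed
  show ?thesis
    by (intro ext) (auto simp: metric_form_def tensor_def covector_def *[symmetric])
qed

lemma alt_forms_eq_zero:
  fixes \<theta> :: "'a::real_vector list \<Rightarrow> real"
  assumes "\<theta> \<in> alt_forms p" "finite B" "span B = (UNIV :: 'a set)" "dim (UNIV :: 'a set) < p"
  shows "\<theta> xs = 0"
proof (cases "length xs = p \<and> distinct xs")
  case False
  then show ?thesis using assms(1) by (auto simp: alt_forms_def)
next
  case True
  have "dependent (set xs)"
  proof (rule ccontr)
    assume ind: "independent (set xs)"
    obtain C where C: "C \<subseteq> B" "independent C" "B \<subseteq> span C"
      using maximal_independent_subset by blast
    then have fin: "finite C" and sp: "span C = UNIV"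
      using assms(2,3) finite_subset span_mono[of B "span C"] by (auto simp: span_span)
    have "card (set xs) \<le> card C"
      using independent_span_bound[OF fin ind] sp by auto
    also have "card C = dim (UNIV :: 'a set)"
      using C sp by (metis dim_eq_card_independent dim_span)
    finally show False using assms(4) True by (simp add: distinct_card)
  qed
  then obtain x where x: "x \<in> set xs" "x \<in> span (set xs - {x})"
    by (auto simp: dependent_def)
  then obtain i where i: "i < p" "xs ! i = x" using True by (auto simp: in_set_conv_nth)
  have lin: "linear (\<lambda>v. \<theta> (xs[i := v]))" using assms(1) True i by (auto simp: alt_forms_def)
  have "\<theta> (xs[i := v]) = 0" if v: "v \<in> set xs - {x}" for v
  proof -
    obtain j where j: "j < p" "xs ! j = v" using v True by (auto simp: in_set_conv_nth)
    then have "j \<noteq> i" using i v by auto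
    then have "\<not> distinct (xs[i := v])"
      using i j True by (auto simp: distinct_conv_nth nth_list_update)
    then show ?thesis using assms(1) by (auto simp: alt_forms_def)
  qed
  then have "\<theta> (xs[i := x]) = 0"
    using linear_eq_0_on_span[OF lin, of "set xs - {x}" x] x by blast
  then show ?thesis using i by auto
qed

lemma double_forms_eq_zero:
  assumes "finite B" "span B = (UNIV :: 'a::real_vector set)"
    and "dim (UNIV :: 'a set) < p \<or> dim (UNIV :: 'a set) < q"
  shows "double_forms p q = {\<lambda>(xs :: 'a list) ys. 0}"
proof
  show "double_forms p q \<subseteq> {\<lambda>(xs :: 'a list) ys. 0}"
  proof
    fix \<omega> :: "'a list \<Rightarrow> 'a list \<Rightarrow> real"
    assume "\<omega> \<in> double_forms p q"
    then obtain k and \<theta> \<eta> :: "nat \<Rightarrow> 'a list \<Rightarrow> real" where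
      *: "\<forall>i<k. \<theta> i \<in> alt_forms p \<and> \<eta> i \<in> alt_forms q"
         "\<omega> = (\<lambda>xs ys. \<Sum>i<k. (\<theta> i \<otimes>\<^sub>f \<eta> i) xs ys)"
      unfolding double_forms_def by blast
    have "\<theta> i xs = 0 \<or> \<eta> i ys = 0" if "i < k" for i xs ys
      using assms(3) *(1) that alt_forms_eq_zero[OF _ assms(1,2)] by meson
    then show "\<omega> \<in> {\<lambda>xs ys. 0}"
      unfolding *(2) by (auto simp: tensor_def fun_eq_iff intro!: sum.neutral)
  qed
  have "(\<lambda>xs ys. 0) \<in> (double_forms p q :: ('a list \<Rightarrow> 'a list \<Rightarrow> real) set)"
    unfolding double_forms_def by (intro CollectI exI[of _ 0]) simp
  then show "{\<lambda>(xs :: 'a list) ys. 0} \<subseteq> double_forms p q" by simp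
qed

lemma length_nths_Compl: "length (nths xs S) + length (nths xs (- S)) = length xs"
proof -
  have "card {i. i < length xs \<and> i \<in> S} + card {i. i < length xs \<and> i \<in> - S}
      = card ({i. i < length xs \<and> i \<in> S} \<union> {i. i < length xs \<and> i \<in> - S})"
    by (rule card_Un_disjoint[symmetric]) auto
  also have "{i. i < length xs \<and> i \<in> S} \<union> {i. i < length xs \<and> i \<in> - S} = {..<length xs}" by auto
  finally show ?thesis by (simp add: length_nths)
qed

lemma nths_list_update_notin: "i \<notin> S \<Longrightarrow> nths (xs[i := v]) S = nths xs S"
proof (induction xs arbitrary: i S)
  case (Cons x xs)
  then show ?case by (cases i) (auto simp: nths_Cons)
qed simp

lemma nths_list_update_in:
  assumes "i \<in> S" "i < length xs"
  shows "\<exists>k < length (nths xs S). \<forall>v. nths (xs[i := v]) S = (nths xs S)[k := v]"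
  using assms
proof (induction xs arbitrary: i S)
  case (Cons x xs)
  show ?case
  proof (cases i)
    case 0
    then show ?thesis using Cons.prems by (intro exI[of _ 0]) (simp add: nths_Cons)
  next
    case (Suc i')
    then obtain k where k: "k < length (nths xs {j. Suc j \<in> S})"
        "\<forall>v. nths (xs[i' := v]) {j. Suc j \<in> S} = (nths xs {j. Suc j \<in> S})[k := v]"
      using Cons.IH[of i' "{j. Suc j \<in> S}"] Cons.prems by auto
    then show ?thesis
      using Suc by (intro exI[of _ "if 0 \<in> S then Suc k else k"]) (auto simp: nths_Cons)
  qed
qed simp

lemma nths_not_distinct:
  assumes "i \<in> S" "j \<in> S" "i \<noteq> j" "i < length xs" "j < length xs" "xs ! i = xs ! j"
  shows "\<not> distinct (nths xs S)"
proof
  let ?I = "{k. k < length xs \<and> k \<in> S}"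
  assume "distinct (nths xs S)"
  then have "card (set (nths xs S)) = card ?I" by (simp add: distinct_card length_nths)
  moreover have "set (nths xs S) = (!) xs ` ?I" by (auto simp: set_nths)
  ultimately have "inj_on ((!) xs) ?I" by (intro eq_card_imp_inj_on) auto
  then show False using assms by (auto dest: inj_onD)
qed

lemma nths_transpose:
  assumes "Suc k < length xs" "xs ! k = xs ! Suc k" "(k \<in> S) \<noteq> (Suc k \<in> S)"
  shows "nths xs (Transposition.transpose k (Suc k) ` S) = nths xs S"
proof -
  have xs: "xs = take k xs @ xs ! k # xs ! k # drop (Suc (Suc k)) xs"
    using assms by (metis Cons_nth_drop_Suc Suc_lessD append_take_drop_id)
  obtain us a vs where us: "xs = us @ a # a # vs" "length us = k"
  proof
    show "xs = take k xs @ xs ! k # xs ! k # drop (Suc (Suc k)) xs" by (rule xs)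
    show "length (take k xs) = k" using assms by simp
  qed
  let ?S = "Transposition.transpose k (Suc k) ` S"
  have mem: "j \<in> ?S \<longleftrightarrow> Transposition.transpose k (Suc k) j \<in> S" for j
    by (rule in_transpose_image_iff)
  have other: "j \<in> ?S \<longleftrightarrow> j \<in> S" if "j \<noteq> k" "j \<noteq> Suc k" for j
    using that by (simp add: mem)
  have swapped: "k \<in> ?S \<longleftrightarrow> Suc k \<in> S" "Suc k \<in> ?S \<longleftrightarrow> k \<in> S" by (simp_all add: mem)
  have 1: "nths us ?S = nths us S"
    unfolding nths_def
    by (intro arg_cong[of _ _ "map fst"] filter_cong refl other) (auto simp: us(2) set_zip)
  have 2: "{j. Suc (Suc (j + k)) \<in> ?S} = {j. Suc (Suc (j + k)) \<in> S}"
    by (intro Collect_cong other) auto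
  show ?thesis
    using assms(3) by (auto simp only: us nths_append nths_Cons 1)
      (use assms(3) in \<open>auto simp: swapped 2\<close>)
qed

lemma shuffle_sign_transpose_aux:
  assumes "k \<in> S" "Suc k \<notin> S" "finite S"
  shows "shuffle_sign (Transposition.transpose k (Suc k) ` S) = - shuffle_sign S"
proof -
  let ?t = "Transposition.transpose k (Suc k)"
  let ?inv = "\<lambda>S. {(i, j). i \<in> S \<and> j \<notin> S \<and> j < (i::nat)}"
  have mem: "j \<in> ?t ` S \<longleftrightarrow> ?t j \<in> S" for j
    by (rule in_transpose_image_iff)
  have fin: "finite (?inv S)"
  proof (rule finite_subset)
    show "?inv S \<subseteq> Sigma S (\<lambda>i. {..<i})" by auto
  qed (use assms in auto)
  have "?inv (?t ` S) = insert (Suc k, k) (map_prod ?t ?t ` ?inv S)"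
  proof (intro set_eqI)
    fix z :: "nat \<times> nat"
    obtain i j where z: "z = (i, j)" by force
    have "z \<in> map_prod ?t ?t ` ?inv S \<longleftrightarrow> (?t i, ?t j) \<in> ?inv S"
      unfolding z by (force simp: image_iff intro: transpose_involutory[symmetric])
    moreover have "z \<in> ?inv (?t ` S) \<longleftrightarrow> ?t i \<in> S \<and> ?t j \<notin> S \<and> j < i"
      unfolding z by (simp add: mem)
    ultimately show "z \<in> ?inv (?t ` S) \<longleftrightarrow> z \<in> insert (Suc k, k) (map_prod ?t ?t ` ?inv S)"
      using assms(1,2) unfolding z by (auto simp: Transposition.transpose_def split: if_splits)
  qed
  moreover have "(Suc k, k) \<notin> map_prod ?t ?t ` ?inv S"
    using assms by (auto simp: Transposition.transpose_def split: if_splits)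
  moreover have "card (map_prod ?t ?t ` ?inv S) = card (?inv S)"
    by (intro card_image) (auto simp: inj_on_def dest: transpose_eq_imp_eq)
  ultimately show ?thesis
    using fin by (simp add: shuffle_sign_def)
qed

lemma shuffle_sign_transpose:
  assumes "(k \<in> S) \<noteq> (Suc k \<in> S)" "finite S"
  shows "shuffle_sign (Transposition.transpose k (Suc k) ` S) = - shuffle_sign S"
proof (cases "k \<in> S")
  case True
  then show ?thesis using shuffle_sign_transpose_aux assms by blast
next
  case False
  let ?S = "Transposition.transpose k (Suc k) ` S"
  have "k \<in> ?S" "Suc k \<notin> ?S"
    using False assms by (auto simp: image_iff Transposition.transpose_def split: if_splits)
  then show ?thesis
    using shuffle_sign_transpose_aux[of k ?S] assms(2) by (simp add: image_image)
qed

lemma wedge_adjacent: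
  assumes \<alpha>: "\<alpha> \<in> alt_forms p" and \<beta>: "\<beta> \<in> alt_forms q"
    and k: "Suc k < length xs" "xs ! k = xs ! Suc k"
  shows "(\<alpha> \<and>\<^sub>f \<beta>) xs = 0"
proof -
  let ?t = "Transposition.transpose k (Suc k)"
  let ?P = "Pow {..<length xs}"
  let ?f = "\<lambda>S. shuffle_sign S * \<alpha> (nths xs S) * \<beta> (nths xs (- S))"
  have tt: "?t ` {..<length xs} = {..<length xs}"
    using k by (intro transpose_image_eq) auto
  have bij: "bij_betw ((`) ?t) ?P ?P"
  proof (rule bij_betw_byWitness[where f' = "(`) ?t"])
    have "?t ` S \<subseteq> {..<length xs}" if "S \<subseteq> {..<length xs}" for S
      using image_mono[OF that, of ?t] tt by simp
    then show "(`) ?t ` ?P \<subseteq> ?P" by auto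
    then show "(`) ?t ` ?P \<subseteq> ?P" .
  qed (auto simp: image_image)
  have neg: "?f (?t ` S) = - ?f S" if S: "S \<in> ?P" for S
  proof -
    have fin: "finite S" using S finite_subset by auto
    have Compl: "- (?t ` S) = ?t ` (- S)" by (simp add: bij_image_Compl_eq)
    show ?thesis
    proof (cases "(k \<in> S) = (Suc k \<in> S)")
      case True
      have "?f S = 0"
      proof (cases "k \<in> S")
        case T: True
        have "\<not> distinct (nths xs S)"
          by (rule nths_not_distinct[of k _ "Suc k"]) (use T True k in auto)
        then show ?thesis using \<alpha> by (simp add: alt_forms_def)
      next
        case F: False
        have "\<not> distinct (nths xs (- S))"
          by (rule nths_not_distinct[of k _ "Suc k"]) (use F True k in auto)
        then show ?thesis using \<beta> by (simp add: alt_forms_def)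
      qed
      moreover have "?t ` S = S" using True by (rule transpose_image_eq)
      ultimately show ?thesis by simp
    next
      case False
      then show ?thesis
        using nths_transpose[OF k] shuffle_sign_transpose[OF _ fin] by (simp add: Compl)
    qed
  qed
  have "sum ?f ?P = (\<Sum>S\<in>?P. ?f (?t ` S))"
    using sum.reindex_bij_betw[OF bij, of ?f] by simp
  also have "\<dots> = - sum ?f ?P" using neg by (simp add: sum_negf)
  finally show ?thesis by (simp add: wedge_def)
qed

lemma wedge_linear:
  assumes \<alpha>: "\<alpha> \<in> alt_forms p" and \<beta>: "\<beta> \<in> alt_forms q" and i: "i < length xs"
  shows "linear (\<lambda>v. (\<alpha> \<and>\<^sub>f \<beta>) (xs[i := v]))"
proof -
  have lin: "linear (\<lambda>v. \<gamma> (ys[k := v]))" if "\<gamma> \<in> alt_forms r" "k < length ys" for \<gamma> ys k r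
    using that by (cases "length ys = r") (auto simp: alt_forms_def linear_iff)
  have "linear (\<lambda>v. shuffle_sign S * \<alpha> (nths (xs[i := v]) S) * \<beta> (nths (xs[i := v]) (- S)))" for S
  proof (cases "i \<in> S")
    case True
    then obtain k where "k < length (nths xs S)" "\<forall>v. nths (xs[i := v]) S = (nths xs S)[k := v]"
      using nths_list_update_in i by blast
    then show ?thesis
      using True lin[OF \<alpha>, of k "nths xs S"]
      by (simp add: nths_list_update_notin linear_iff algebra_simps)
  next
    case False
    then obtain k where
      "k < length (nths xs (- S))" "\<forall>v. nths (xs[i := v]) (- S) = (nths xs (- S))[k := v]"
      using nths_list_update_in[of i "- S"] i by blast
    then show ?thesis
      using False lin[OF \<beta>, of k "nths xs (- S)"]
      by (simp add: nths_list_update_notin linear_iff algebra_simps)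
  qed
  then show ?thesis by (auto simp: wedge_def intro: linear_compose_sum)
qed

lemma wedge_alt_form:
  assumes \<alpha>: "\<alpha> \<in> alt_forms p" and \<beta>: "\<beta> \<in> alt_forms q"
  shows "\<alpha> \<and>\<^sub>f \<beta> \<in> alt_forms (p + q)"
proof -
  let ?f = "\<alpha> \<and>\<^sub>f \<beta>"
  have len: "?f xs = 0" if "length xs \<noteq> p + q" for xs
  proof -
    have "\<alpha> (nths xs S) * \<beta> (nths xs (- S)) = 0" for S
      using length_nths_Compl[of xs S] that \<alpha> \<beta>
      by (cases "length (nths xs S) = p") (auto simp: alt_forms_def)
    then show ?thesis unfolding wedge_def by (intro sum.neutral) (auto simp: mult.assoc simp del: mult_eq_0_iff)
  qed
  have swap: "?f (xs[k := b, Suc k := a]) = - ?f (xs[k := a, Suc k := b])"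
    if k: "Suc k < length xs" for xs k a b
  proof -
    let ?g = "\<lambda>u v. ?f (xs[k := u, Suc k := v])"
    have l2: "linear (?g u)" for u
      using wedge_linear[OF \<alpha> \<beta>, of "Suc k" "xs[k := u]"] k by simp
    have l1: "linear (\<lambda>u. ?g u v)" for v
      using wedge_linear[OF \<alpha> \<beta>, of k "xs[Suc k := v]"] k
      by (simp add: list_update_swap[of k "Suc k"])
    have z: "?g u u = 0" for u
      by (rule wedge_adjacent[OF \<alpha> \<beta>, of k]) (use k in \<open>auto simp: nth_list_update\<close>)
    have "?g (a + b) (a + b) = ?g a a + ?g a b + (?g b a + ?g b b)"
      by (simp only: linear_add[OF l1] linear_add[OF l2])
    then show ?thesis using z by simp
  qed
  have alt: "?f xs = 0" if "i + Suc d < length xs" "xs ! i = xs ! (i + Suc d)" for xs i d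
    using that
  proof (induction d arbitrary: xs)
    case 0
    then show ?case using wedge_adjacent[OF \<alpha> \<beta>, of i] by simp
  next
    case (Suc d)
    let ?k = "i + Suc d"
    let ?ys = "xs[?k := xs ! Suc ?k, Suc ?k := xs ! ?k]"
    have "?f ?ys = 0"
      by (rule Suc.IH) (use Suc.prems in \<open>auto simp: nth_list_update\<close>)
    moreover have "?f ?ys = - ?f xs"
      using swap[of ?k xs "xs ! Suc ?k" "xs ! ?k"] Suc.prems by simp
    ultimately show ?case by simp
  qed
  have "?f xs = 0" if nd: "\<not> distinct xs" for xs
  proof -
    obtain i j where "i < j" "j < length xs" "xs ! i = xs ! j"
      using nd by (metis distinct_conv_nth linorder_neqE_nat)
    then show ?thesis using alt[of i "j - Suc i" xs] by simp
  qed
  then show ?thesis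
    using len wedge_linear[OF \<alpha> \<beta>] by (auto simp: alt_forms_def)
qed

lemma dmult_double_forms:
  fixes \<omega> \<eta> :: "'a::real_vector list \<Rightarrow> 'a list \<Rightarrow> real"
  assumes \<omega>: "\<omega> \<in> double_forms p q" and \<eta>: "\<eta> \<in> double_forms r s"
  shows "\<omega> \<cdot>\<^sub>d \<eta> \<in> double_forms (p + r) (q + s)"
proof -
  obtain k and \<theta> \<theta>' :: "nat \<Rightarrow> 'a list \<Rightarrow> real" where
    1: "\<forall>i<k. \<theta> i \<in> alt_forms p \<and> \<theta>' i \<in> alt_forms q"
       "\<omega> = (\<lambda>xs ys. \<Sum>i<k. (\<theta> i \<otimes>\<^sub>f \<theta>' i) xs ys)"
    using \<omega> unfolding double_forms_def by blast
  obtain l and \<zeta> \<zeta>' :: "nat \<Rightarrow> 'a list \<Rightarrow> real" where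
    2: "\<forall>j<l. \<zeta> j \<in> alt_forms r \<and> \<zeta>' j \<in> alt_forms s"
       "\<eta> = (\<lambda>xs ys. \<Sum>j<l. (\<zeta> j \<otimes>\<^sub>f \<zeta>' j) xs ys)"
    using \<eta> unfolding double_forms_def by blast
  let ?h = "\<lambda>m. \<theta> (m div l) \<and>\<^sub>f \<zeta> (m mod l)" and ?h' = "\<lambda>m. \<theta>' (m div l) \<and>\<^sub>f \<zeta>' (m mod l)"
  have "\<omega> \<cdot>\<^sub>d \<eta> = (\<lambda>xs ys. \<Sum>i<k. \<Sum>j<l. ((\<theta> i \<and>\<^sub>f \<zeta> j) \<otimes>\<^sub>f (\<theta>' i \<and>\<^sub>f \<zeta>' j)) xs ys)"
    unfolding 1(2) 2(2)
    using dmult_sum[where I = "{..<k}" and a = "\<lambda>_. 1" and \<omega> = "\<lambda>i. \<theta> i \<otimes>\<^sub>f \<theta>' i" and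
        J = "{..<l}" and b = "\<lambda>_. 1" and \<eta> = "\<lambda>j. \<zeta> j \<otimes>\<^sub>f \<zeta>' j"]
    by (simp add: dmult_tensor)
  also have "\<dots> = (\<lambda>xs ys. \<Sum>m<k * l. (?h m \<otimes>\<^sub>f ?h' m) xs ys)"
  proof (intro ext)
    fix xs ys :: "'a list"
    have "(\<Sum>i<k. \<Sum>j<l. ((\<theta> i \<and>\<^sub>f \<zeta> j) \<otimes>\<^sub>f (\<theta>' i \<and>\<^sub>f \<zeta>' j)) xs ys)
        = (\<Sum>i<k. sum (\<lambda>m. (?h m \<otimes>\<^sub>f ?h' m) xs ys) {i * l..<i * l + l})"
    proof (rule sum.cong[OF refl])
      fix i
      have "sum (\<lambda>m. (?h m \<otimes>\<^sub>f ?h' m) xs ys) {i * l..<i * l + l}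
          = (\<Sum>j<l. (?h (j + i * l) \<otimes>\<^sub>f ?h' (j + i * l)) xs ys)"
        using sum.shift_bounds_nat_ivl[of "\<lambda>m. (?h m \<otimes>\<^sub>f ?h' m) xs ys" 0 "i * l" l]
        by (simp add: atLeast0LessThan add.commute)
      also have "\<dots> = (\<Sum>j<l. ((\<theta> i \<and>\<^sub>f \<zeta> j) \<otimes>\<^sub>f (\<theta>' i \<and>\<^sub>f \<zeta>' j)) xs ys)"
        by (intro sum.cong) auto
      finally show "(\<Sum>j<l. ((\<theta> i \<and>\<^sub>f \<zeta> j) \<otimes>\<^sub>f (\<theta>' i \<and>\<^sub>f \<zeta>' j)) xs ys)
          = sum (\<lambda>m. (?h m \<otimes>\<^sub>f ?h' m) xs ys) {i * l..<i * l + l}" by simp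
    qed
    also have "\<dots> = (\<Sum>m<k * l. (?h m \<otimes>\<^sub>f ?h' m) xs ys)"
      by (rule sum.nat_group)
    finally show "(\<Sum>i<k. \<Sum>j<l. ((\<theta> i \<and>\<^sub>f \<zeta> j) \<otimes>\<^sub>f (\<theta>' i \<and>\<^sub>f \<zeta>' j)) xs ys)
        = (\<Sum>m<k * l. (?h m \<otimes>\<^sub>f ?h' m) xs ys)" .
  qed
  finally have eq: "\<omega> \<cdot>\<^sub>d \<eta> = (\<lambda>xs ys. \<Sum>m<k * l. (?h m \<otimes>\<^sub>f ?h' m) xs ys)" .
  have "?h m \<in> alt_forms (p + r) \<and> ?h' m \<in> alt_forms (q + s)" if "m < k * l" for m
  proof -
    have "0 < l" using that by (cases l) auto
    then have "m div l < k" "m mod l < l"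
      using that by (auto simp: less_mult_imp_div_less)
    then show ?thesis using 1(1) 2(1) wedge_alt_form by blast
  qed
  then show ?thesis
    unfolding double_forms_def eq
    by (intro CollectI exI[of _ "k * l"] exI[of _ ?h] exI[of _ ?h'] conjI allI impI refl) auto
qed

end

theory Submission
  imports Defs
begin

text \<open>
  Let \<open>c\<close> be the contraction of double forms along an orthonormal basis. On \<open>D\<^sup>p\<^sup>,\<^sup>q\<close> it satisfies
  \<open>c g - g c = h\<close> with \<open>h = n - p - q\<close>, hence
  \<open>c\<^bsup>j+1\<^esup> g - g c\<^bsup>j+1\<^esup> = (j + 1) (h + j) c\<^bsup>j\<^esup>\<close>.
  If \<open>h > 0\<close> and \<open>g \<omega> = 0\<close>, then \<open>c\<^bsup>j+1\<^esup> \<omega> = 0\<close> implies \<open>c\<^bsup>j\<^esup> \<omega> = 0\<close>; since \<open>c\<close> is nilpotent, \<open>\<omega> = 0\<close>.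
  If \<open>\<eta>\<close> has \<open>h < 0\<close>, the formula applied to \<open>g\<^bsup>j\<^esup> \<eta>\<close> shows that \<open>c\<^bsup>j\<^esup> g\<^bsup>j\<^esup> \<eta>\<close> lies in the range of \<open>g\<close> once
  \<open>c\<^bsup>j+1\<^esup> g\<^bsup>j+1\<^esup> \<eta>\<close> does; since \<open>g\<close> is nilpotent, so does \<open>\<eta>\<close>.
  Conversely, \<open>g (e\<^sub>I \<otimes> e\<^sub>J) = 0\<close> when \<open>I\<close> and \<open>J\<close> cover the basis, which is possible if \<open>p + q \<ge> n\<close>, and
  no element of the range has an \<open>e\<^sub>I \<otimes> e\<^sub>J\<close> component with \<open>I\<close> and \<open>J\<close> disjoint, which is possible in
  \<open>D\<^bsup>p+1,q+1\<^esup>\<close> if \<open>p + q + 2 \<le> n\<close>.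
\<close>

section \<open>Alternating forms\<close>

text \<open>Phrased with \<open>nths\<close> because \<open>nths xs (- {i})\<close> is exactly the
  complementary argument of a shuffle that selects the single position \<open>i\<close>.\<close>

definition del_nth :: "nat \<Rightarrow> 'a list \<Rightarrow> 'a list" where
  "del_nth i xs = nths xs (- {i})"

lemma del_nth_eq: "i < length xs \<Longrightarrow> del_nth i xs = take i xs @ drop (Suc i) xs"
proof (induction xs arbitrary: i)
  case (Cons x xs)
  show ?case
  proof (cases i)
    case 0
    have "{j. Suc j \<in> - {0}} = UNIV" by auto
    then show ?thesis using 0 by (simp add: del_nth_def nths_Cons nths_all)
  next
    case (Suc k)
    have "{j. Suc j \<in> - {Suc k}} = - {k}" by auto
    then show ?thesis using Suc Cons by (simp add: del_nth_def nths_Cons)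
  qed
qed simp

lemma del_nth_0_Cons [simp]: "del_nth 0 (x # xs) = xs"
  by (simp add: del_nth_eq)

lemma del_nth_Suc_Cons [simp]: "i < length xs \<Longrightarrow> del_nth (Suc i) (x # xs) = x # del_nth i xs"
  by (simp add: del_nth_eq)

lemma length_del_nth [simp]: "i < length xs \<Longrightarrow> length (del_nth i xs) = length xs - 1"
  by (simp add: del_nth_eq)

lemma set_del_nth: "i < length xs \<Longrightarrow> set (del_nth i xs) \<subseteq> set xs"
  using set_take_subset set_drop_subset by (fastforce simp: del_nth_eq)

lemma nth_notin_del_nth:
  assumes "distinct xs" "i < length xs"
  shows "xs ! i \<notin> set (del_nth i xs)"
proof -
  have "distinct (take i xs @ xs ! i # drop (Suc i) xs)"
    using assms id_take_nth_drop by metis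
  then show ?thesis using assms(2) by (auto simp: del_nth_eq)
qed

lemma shuffle_sign_singleton: "shuffle_sign {i} = (- 1) ^ i"
proof -
  have "{(k, j). k \<in> {i} \<and> j \<notin> {i} \<and> j < k} = Pair i ` {..<i}" by auto
  then show ?thesis by (simp add: shuffle_sign_def card_image inj_on_def)
qed

lemma nths_singleton: "i < length xs \<Longrightarrow> nths xs {i} = [xs ! i]"
proof (induction xs arbitrary: i)
  case (Cons x xs)
  show ?case
  proof (cases i)
    case 0
    then show ?thesis by (simp add: nths_Cons)
  next
    case (Suc k)
    have "{j. Suc j \<in> {Suc k}} = {k}" by auto
    then show ?thesis using Suc Cons by (simp add: nths_Cons)
  qed
qed simp

text \<open>When one factor has degree 1, only shuffles selecting a single position contribute, so
  the sum over subsets collapses to a sum over positions.\<close>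

lemma sum_Pow_length_1:
  fixes f :: "nat set \<Rightarrow> real"
  assumes "\<And>S. length (nths xs S) \<noteq> 1 \<Longrightarrow> f S = 0"
  shows "(\<Sum>S\<in>Pow {..<length xs}. f S) = (\<Sum>i<length xs. f {i})"
proof -
  have "(\<Sum>S\<in>Pow {..<length xs}. f S) = (\<Sum>S\<in>(\<lambda>i. {i}) ` {..<length xs}. f S)"
  proof (rule sum.mono_neutral_right)
    show "\<forall>S\<in>Pow {..<length xs} - (\<lambda>i. {i}) ` {..<length xs}. f S = 0"
    proof
      fix S assume S: "S \<in> Pow {..<length xs} - (\<lambda>i. {i}) ` {..<length xs}"
      then have "{i. i < length xs \<and> i \<in> S} = S" by auto
      then have "length (nths xs S) = card S" by (simp add: length_nths)
      moreover have "card S \<noteq> 1" using S by (auto simp: card_1_singleton_iff)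
      ultimately show "f S = 0" using assms by simp
    qed
  qed auto
  also have "\<dots> = (\<Sum>i<length xs. f {i})" by (simp add: sum.reindex)
  finally show ?thesis .
qed

text \<open>Laplace expansion along the first factor; the shuffle selecting position
  \<open>i\<close> has \<open>i\<close> inversions.\<close>

lemma covector_wedge:
  "(covector b \<and>\<^sub>f \<beta>) xs = (\<Sum>i<length xs. (- 1) ^ i * inner b (xs ! i) * \<beta> (del_nth i xs))"
  unfolding wedge_def
  by (subst sum_Pow_length_1)
    (auto simp: covector_def shuffle_sign_singleton nths_singleton del_nth_def)

text \<open>The metric has degree 1 in each list, so both shuffle sums collapse independently. All
  later computations with the product start from this formula.\<close>

lemma metric_dmult:
  "(metric_form \<cdot>\<^sub>d \<omega>) xs ys = (\<Sum>i<length xs. \<Sum>j<length ys.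
     (- 1) ^ (i + j) * inner (xs ! i) (ys ! j) * \<omega> (del_nth i xs) (del_nth j ys))"
proof -
  have "(metric_form \<cdot>\<^sub>d \<omega>) xs ys = (\<Sum>i<length xs. \<Sum>T\<in>Pow {..<length ys}.
        shuffle_sign {i} * shuffle_sign T * metric_form (nths xs {i}) (nths ys T) *
        \<omega> (nths xs (- {i})) (nths ys (- T)))"
    unfolding dmult_def by (rule sum_Pow_length_1) (simp add: metric_form_def)
  also have "\<dots> = (\<Sum>i<length xs. \<Sum>j<length ys.
        shuffle_sign {i} * shuffle_sign {j} * metric_form (nths xs {i}) (nths ys {j}) *
        \<omega> (nths xs (- {i})) (nths ys (- {j})))"
    by (intro sum.cong refl sum_Pow_length_1) (simp add: metric_form_def)
  finally show ?thesis
    by (simp add: metric_form_def shuffle_sign_singleton nths_singleton del_nth_def power_add)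
qed

section \<open>Multilinearity and antisymmetry of alternating forms\<close>

lemma alt_forms_length: "\<theta> \<in> alt_forms p \<Longrightarrow> length xs \<noteq> p \<Longrightarrow> \<theta> xs = 0"
  by (simp add: alt_forms_def)

lemma alt_forms_not_distinct: "\<theta> \<in> alt_forms p \<Longrightarrow> \<not> distinct xs \<Longrightarrow> \<theta> xs = 0"
  by (simp add: alt_forms_def)

lemma alt_forms_linear:
  assumes "\<theta> \<in> alt_forms p"
  shows "linear (\<lambda>v. \<theta> (us @ v # vs))"
\<comment> \<open>\<open>undefined\<close> only fills the slot of \<open>v\<close>; the length does
  not depend on it. On lists of the wrong length the map is zero, hence linear.\<close>
proof (cases "length (us @ undefined # vs) = p")
  case True
  have "\<forall>xs i. length xs = p \<longrightarrow> i < p \<longrightarrow> linear (\<lambda>v. \<theta> (xs[i := v]))"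
    using assms by (simp add: alt_forms_def)
  moreover have "length us < p" using True by auto
  ultimately have "linear (\<lambda>v. \<theta> ((us @ undefined # vs)[length us := v]))"
    using True by blast
  then show ?thesis by simp
next
  case False
  then have "\<theta> (us @ v # vs) = 0" for v by (intro alt_forms_length[OF assms]) simp
  then show ?thesis by (simp add: linear_iff)
qed

text \<open>Polarization: expand the form with \<open>a + b\<close> in both slots, where it vanishes
  along with its two diagonal terms.\<close>

lemma alt_forms_swap:
  assumes \<theta>: "\<theta> \<in> alt_forms p"
  shows "\<theta> (us @ a # b # vs) = - \<theta> (us @ b # a # vs)"
proof -
  let ?g = "\<lambda>u v. \<theta> (us @ u # v # vs)"
  have l1: "linear (\<lambda>u. ?g u v)" for v by (rule alt_forms_linear[OF \<theta>])
  have l2: "linear (?g u)" for u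
    using alt_forms_linear[OF \<theta>, of "us @ [u]" vs] by simp
  have z: "?g u u = 0" for u by (rule alt_forms_not_distinct[OF \<theta>]) simp
  have "?g (a + b) (a + b) = ?g a a + ?g a b + (?g b a + ?g b b)"
    by (simp only: linear_add[OF l1] linear_add[OF l2])
  then show ?thesis using z by simp
qed

text \<open>\<open>x\<close> passes the entries of \<open>ws\<close> one at a time, each adjacent
  swap costing a sign.\<close>

lemma alt_forms_move:
  assumes \<theta>: "\<theta> \<in> alt_forms p"
  shows "\<theta> (us @ x # ws @ vs) = (- 1) ^ length ws * \<theta> (us @ ws @ x # vs)"
proof (induction ws arbitrary: us)
  case (Cons w ws)
  show ?case
    using alt_forms_swap[OF \<theta>, of us x w "ws @ vs"] Cons[of "us @ [w]"] by simp
qed simp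

lemma alt_forms_move_front:
  assumes "\<theta> \<in> alt_forms p" "i < length xs"
  shows "\<theta> (xs ! i # del_nth i xs) = (- 1) ^ i * \<theta> xs"
  using alt_forms_move[OF assms(1), of "[]" "xs ! i" "take i xs" "drop (Suc i) xs"] assms(2)
  by (simp add: del_nth_eq id_take_nth_drop[symmetric])

lemma alt_forms_scale: "\<theta> \<in> alt_forms p \<Longrightarrow> (\<lambda>xs. a * \<theta> xs) \<in> alt_forms p"
  by (auto simp: alt_forms_def linear_iff algebra_simps)

lemma alt_forms_sum:
  assumes "\<And>i. i \<in> I \<Longrightarrow> \<theta> i \<in> alt_forms p"
  shows "(\<lambda>xs. \<Sum>i\<in>I. \<theta> i xs) \<in> alt_forms p"
  using assms unfolding alt_forms_def
  by (auto intro!: sum.neutral linear_compose_sum)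

lemma alt_forms_Cons:
  assumes \<theta>: "\<theta> \<in> alt_forms (Suc p)"
  shows "(\<lambda>xs. \<theta> (b # xs)) \<in> alt_forms p"
  unfolding alt_forms_def
proof (intro CollectI conjI allI impI)
  fix xs :: "'a list" and i assume "length xs = p" "i < p"
  then show "linear (\<lambda>v. \<theta> (b # xs[i := v]))"
    using alt_forms_linear[OF \<theta>, of "b # take i xs" "drop (Suc i) xs"]
    by (simp add: upd_conv_take_nth_drop)
qed (use alt_forms_length[OF \<theta>] alt_forms_not_distinct[OF \<theta>] in auto)

text \<open>Arguments are freed from the basis one by one: the induction runs over the arbitrary
  suffix, for every prefix of basis vectors, and uses linearity in the slot between them.\<close>

lemma alt_forms_eq_zero_on_basis:
  assumes \<theta>: "\<theta> \<in> alt_forms p" and B: "span B = UNIV"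
    and zero: "\<And>xs. set xs \<subseteq> B \<Longrightarrow> \<theta> xs = 0"
  shows "\<theta> xs = 0"
proof -
  have "\<theta> (us @ xs) = 0" if "set us \<subseteq> B" for us
    using that
  proof (induction xs arbitrary: us)
    case Nil
    then show ?case using zero by simp
  next
    case (Cons x xs)
    have "\<theta> (us @ b # xs) = 0" if "b \<in> B" for b
      using Cons.IH[of "us @ [b]"] Cons.prems that by simp
    then show ?case
      using linear_eq_0_on_span[OF alt_forms_linear[OF \<theta>, of us xs], of B x] B by blast
  qed
  from this[of "[]"] show ?thesis by simp
qed

section \<open>Wedge products of covectors\<close>

text \<open>The decomposable forms; on a list of the same length the value is the determinant of the
  inner products. The empty product is the scalar 1, which as a form of degree 0 is supported on the
  empty list.\<close>

primrec wedge_list :: "'a::real_inner list \<Rightarrow> 'a list \<Rightarrow> real" where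
  "wedge_list [] = (\<lambda>xs. if xs = [] then 1 else 0)"
| "wedge_list (b # bs) = covector b \<and>\<^sub>f wedge_list bs"

lemma wedge_list_alt_form: "wedge_list bs \<in> alt_forms (length bs)"
proof (induction bs)
  case (Cons b bs)
  then show ?case using wedge_alt_form[OF covector_alt_form[of b] Cons] by simp
qed (auto simp: alt_forms_def)

text \<open>Expanding along the first covector leaves only the term of index 0, by
  orthogonality.\<close>

lemma wedge_list_self:
  assumes "distinct bs" "pairwise orthogonal (set bs)" "\<And>b. b \<in> set bs \<Longrightarrow> norm b = 1"
  shows "wedge_list bs bs = 1"
  using assms
proof (induction bs)
  case (Cons b bs)
  have *: "inner b (bs ! i) = 0" if "i < length bs" for i
  proof -
    have "bs ! i \<in> set bs" using that by simp
    then show ?thesis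
      using Cons.prems(1,2) by (auto simp: pairwise_def orthogonal_def)
  qed
  have "wedge_list bs bs = 1"
    using Cons by (simp add: pairwise_insert)
  moreover have "inner b b = 1" using Cons.prems(3) by (simp add: norm_eq_1)
  ultimately show ?case
    by (simp add: covector_wedge sum.lessThan_Suc_shift * del: sum.lessThan_Suc)
qed simp

text \<open>The vector \<open>b\<close> gives a zero row of the determinant. In the expansion along
  the first covector, that row is either the one expanded or still present in the minors.\<close>

lemma wedge_list_eq_zero:
  assumes "b \<in> set bs" "\<And>x. x \<in> set xs \<Longrightarrow> inner b x = 0"
  shows "wedge_list bs xs = 0"
  using assms
proof (induction bs arbitrary: xs)
  case (Cons a bs)
  have "inner a (xs ! i) * wedge_list bs (del_nth i xs) = 0" if "i < length xs" for i
  proof (cases "a = b")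
    case True
    then show ?thesis using Cons.prems that by simp
  next
    case False
    then have "wedge_list bs (del_nth i xs) = 0"
      using Cons.prems set_del_nth[OF that] by (intro Cons.IH) auto
    then show ?thesis by simp
  qed
  then show ?case
    by (auto simp: covector_wedge mult.assoc intro!: sum.neutral)
qed simp

section \<open>Double forms\<close>

lemma double_forms_zero: "(\<lambda>xs ys. 0) \<in> double_forms p q"
  unfolding double_forms_def by (intro CollectI exI[of _ 0]) simp

lemma tensor_double_forms:
  assumes "\<theta> \<in> alt_forms p" "\<eta> \<in> alt_forms q"
  shows "\<theta> \<otimes>\<^sub>f \<eta> \<in> double_forms p q"
  unfolding double_forms_def
  by (intro CollectI exI[of _ 1] exI[of _ "\<lambda>_. \<theta>"] exI[of _ "\<lambda>_. \<eta>"])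
    (use assms in auto)

lemma double_forms_add:
  assumes "\<omega> \<in> double_forms p q" "\<omega>' \<in> double_forms p q"
  shows "(\<lambda>xs ys. \<omega> xs ys + \<omega>' xs ys) \<in> double_forms p q"
proof -
  obtain k :: nat and \<theta> \<eta> where 1:
    "\<forall>i<k. \<theta> i \<in> alt_forms p \<and> \<eta> i \<in> alt_forms q"
    "\<omega> = (\<lambda>xs ys. \<Sum>i<k. (\<theta> i \<otimes>\<^sub>f \<eta> i) xs ys)"
    using assms(1) unfolding double_forms_def by blast
  obtain l :: nat and \<theta>' \<eta>' where 2:
    "\<forall>i<l. \<theta>' i \<in> alt_forms p \<and> \<eta>' i \<in> alt_forms q"
    "\<omega>' = (\<lambda>xs ys. \<Sum>i<l. (\<theta>' i \<otimes>\<^sub>f \<eta>' i) xs ys)"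
    using assms(2) unfolding double_forms_def by blast
  \<comment> \<open>The two families of simple tensors are concatenated, the second shifted by
    \<open>k\<close>.\<close>
  let ?\<theta> = "\<lambda>i. if i < k then \<theta> i else \<theta>' (i - k)"
  let ?\<eta> = "\<lambda>i. if i < k then \<eta> i else \<eta>' (i - k)"
  have "(\<Sum>i<k + l. (?\<theta> i \<otimes>\<^sub>f ?\<eta> i) xs ys) = \<omega> xs ys + \<omega>' xs ys" for xs ys
    unfolding 1(2) 2(2) by (induction l) simp_all
  then show ?thesis
    unfolding double_forms_def
    by (intro CollectI exI[of _ "k + l"] exI[of _ ?\<theta>] exI[of _ ?\<eta>]) (use 1(1) 2(1) in auto)
qed

lemma double_forms_scale:
  assumes "\<omega> \<in> double_forms p q"
  shows "(\<lambda>xs ys. a * \<omega> xs ys) \<in> double_forms p q"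
proof -
  obtain k :: nat and \<theta> \<eta> where 1:
    "\<forall>i<k. \<theta> i \<in> alt_forms p \<and> \<eta> i \<in> alt_forms q"
    "\<omega> = (\<lambda>xs ys. \<Sum>i<k. (\<theta> i \<otimes>\<^sub>f \<eta> i) xs ys)"
    using assms unfolding double_forms_def by blast
  show ?thesis
    unfolding double_forms_def 1(2)
    by (intro CollectI exI[of _ k] exI[of _ "\<lambda>i xs. a * \<theta> i xs"] exI[of _ \<eta>])
      (use 1(1) alt_forms_scale in \<open>auto simp: tensor_def sum_distrib_left mult.assoc\<close>)
qed

lemma double_forms_sum:
  assumes "\<And>i. i \<in> I \<Longrightarrow> \<omega> i \<in> double_forms p q"
  shows "(\<lambda>xs ys. \<Sum>i\<in>I. \<omega> i xs ys) \<in> double_forms p q"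
  using assms
  by (induction I rule: infinite_finite_induct) (auto intro: double_forms_zero double_forms_add)

lemma double_forms_alt_left:
  assumes "\<omega> \<in> double_forms p q"
  shows "(\<lambda>xs. \<omega> xs ys) \<in> alt_forms p"
proof -
  obtain k :: nat and \<theta> \<eta> where 1:
    "\<forall>i<k. \<theta> i \<in> alt_forms p \<and> \<eta> i \<in> alt_forms q"
    "\<omega> = (\<lambda>xs ys. \<Sum>i<k. (\<theta> i \<otimes>\<^sub>f \<eta> i) xs ys)"
    using assms unfolding double_forms_def by blast
  have "(\<lambda>xs. \<Sum>i<k. \<eta> i ys * \<theta> i xs) \<in> alt_forms p"
    using 1(1) by (intro alt_forms_sum alt_forms_scale) auto
  then show ?thesis unfolding 1(2) by (simp add: tensor_def mult.commute)
qed

lemma double_forms_alt_right: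
  assumes "\<omega> \<in> double_forms p q"
  shows "\<omega> xs \<in> alt_forms q"
proof -
  obtain k :: nat and \<theta> \<eta> where 1:
    "\<forall>i<k. \<theta> i \<in> alt_forms p \<and> \<eta> i \<in> alt_forms q"
    "\<omega> = (\<lambda>xs ys. \<Sum>i<k. (\<theta> i \<otimes>\<^sub>f \<eta> i) xs ys)"
    using assms unfolding double_forms_def by blast
  have "(\<lambda>ys. \<Sum>i<k. \<theta> i xs * \<eta> i ys) \<in> alt_forms q"
    using 1(1) by (intro alt_forms_sum alt_forms_scale) auto
  then show ?thesis unfolding 1(2) by (simp add: tensor_def)
qed

text \<open>One pattern with two coefficients covers sums, differences and multiples; the factors
  \<open>1 *\<close> and \<open>(- 1) *\<close> further on are written to match such
  patterns.\<close>

lemma metric_dmult_linear: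
  "metric_form \<cdot>\<^sub>d (\<lambda>xs ys. a * \<omega> xs ys + b * \<eta> xs ys) =
   (\<lambda>xs ys. a * (metric_form \<cdot>\<^sub>d \<omega>) xs ys + b * (metric_form \<cdot>\<^sub>d \<eta>) xs ys)"
  by (intro ext) (simp add: dmult_def sum_distrib_left sum.distrib algebra_simps)

lemma metric_dmult_zero: "metric_form \<cdot>\<^sub>d (\<lambda>xs ys. 0) = (\<lambda>xs ys. 0)"
  by (intro ext) (simp add: dmult_def)

lemma metric_double_form:
  assumes "finite B" "span B = (UNIV :: 'a::real_inner set)" "pairwise orthogonal B"
    "\<And>b. b \<in> B \<Longrightarrow> norm b = 1"
  shows "(metric_form :: 'a list \<Rightarrow> 'a list \<Rightarrow> real) \<in> double_forms 1 1"
proof -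
  have "metric_form = (\<lambda>xs ys. \<Sum>b\<in>B. (covector b \<otimes>\<^sub>f covector b) xs ys)"
    by (rule metric_form_eq_sum) (use assms in auto)
  moreover have "(\<lambda>xs ys. \<Sum>b\<in>B. (covector b \<otimes>\<^sub>f covector b) xs ys) \<in> double_forms 1 1"
    by (intro double_forms_sum tensor_double_forms covector_alt_form)
  ultimately show ?thesis by - (erule ssubst)
qed

text \<open>The contraction adjoint to multiplication by the metric when \<open>B\<close> is an orthonormal basis.\<close>

definition contraction ::
  "'a set \<Rightarrow> ('a list \<Rightarrow> 'a list \<Rightarrow> real) \<Rightarrow> 'a list \<Rightarrow> 'a list \<Rightarrow> real" where
  "contraction B \<omega> xs ys = (\<Sum>b\<in>B. \<omega> (b # xs) (b # ys))"

lemma contraction_linear: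
  "contraction B (\<lambda>xs ys. a * \<omega> xs ys + b * \<eta> xs ys) =
   (\<lambda>xs ys. a * contraction B \<omega> xs ys + b * contraction B \<eta> xs ys)"
  by (intro ext) (simp add: contraction_def sum_distrib_left sum.distrib)

lemma contraction_zero: "contraction B (\<lambda>xs ys. 0) = (\<lambda>xs ys. 0)"
  by (intro ext) (simp add: contraction_def)

text \<open>Splits off the innermost contraction, as suits inductions that generalise over the
  form.\<close>

lemma contraction_pow_Suc: "(contraction B ^^ Suc j) \<omega> = (contraction B ^^ j) (contraction B \<omega>)"
  unfolding funpow_Suc_right by (rule o_apply)

lemma contraction_pow_linear:
  "(contraction B ^^ j) (\<lambda>xs ys. a * \<omega> xs ys + b * \<eta> xs ys) =
   (\<lambda>xs ys. a * (contraction B ^^ j) \<omega> xs ys + b * (contraction B ^^ j) \<eta> xs ys)"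
proof (induction j arbitrary: \<omega> \<eta>)
  case (Suc j)
  show ?case unfolding contraction_pow_Suc contraction_linear by (rule Suc.IH)
qed simp

lemma contraction_pow_zero: "(contraction B ^^ j) (\<lambda>xs ys. 0) = (\<lambda>xs ys. 0)"
proof (induction j)
  case (Suc j)
  then show ?case unfolding contraction_pow_Suc contraction_zero .
qed simp

text \<open>Contraction acts on each simple tensor by inserting \<open>b\<close> as first argument
  of both factors, which lowers both degrees by one.\<close>

lemma contraction_double_forms:
  assumes "\<omega> \<in> double_forms (Suc p) (Suc q)"
  shows "contraction B \<omega> \<in> double_forms p q"
proof -
  obtain k :: nat and \<theta> \<eta> where 1:
    "\<forall>i<k. \<theta> i \<in> alt_forms (Suc p) \<and> \<eta> i \<in> alt_forms (Suc q)"
    "\<omega> = (\<lambda>xs ys. \<Sum>i<k. (\<theta> i \<otimes>\<^sub>f \<eta> i) xs ys)"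
    using assms unfolding double_forms_def by blast
  have "contraction B \<omega> =
      (\<lambda>xs ys. \<Sum>b\<in>B. \<Sum>i<k. ((\<lambda>xs. \<theta> i (b # xs)) \<otimes>\<^sub>f (\<lambda>ys. \<eta> i (b # ys))) xs ys)"
    by (intro ext) (simp add: contraction_def 1(2) tensor_def)
  also have "\<dots> \<in> double_forms p q"
    using 1(1) by (intro double_forms_sum tensor_double_forms alt_forms_Cons) auto
  finally show ?thesis .
qed

text \<open>A form of degree 0 vanishes on every nonempty list.\<close>

lemma contraction_eq_zero:
  assumes "\<omega> \<in> double_forms p q" "p = 0 \<or> q = 0"
  shows "contraction B \<omega> = (\<lambda>xs ys. 0)"
proof -
  have "\<omega> (b # xs) (b # ys) = 0" for b xs ys
    using assms(2) alt_forms_length[OF double_forms_alt_left[OF assms(1)]]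
      alt_forms_length[OF double_forms_alt_right[OF assms(1)]] by fastforce
  then show ?thesis by (intro ext) (simp add: contraction_def)
qed

lemma contraction_pow_double_forms:
  assumes "\<omega> \<in> double_forms (p + j) (q + j)"
  shows "(contraction B ^^ j) \<omega> \<in> double_forms p q"
  using assms
proof (induction j arbitrary: \<omega>)
  case (Suc j)
  have "contraction B \<omega> \<in> double_forms (p + j) (q + j)"
    using Suc.prems by (intro contraction_double_forms) (simp only: add_Suc_right)
  then show ?case unfolding contraction_pow_Suc by (rule Suc.IH)
qed simp

text \<open>Each contraction lowers both degrees, and the next one after either degree reaches 0
  gives zero. This happens after at most \<open>p + 1\<close> contractions, possibly earlier because
  of \<open>q\<close>.\<close>

lemma contraction_pow_eq_zero:
  assumes "\<omega> \<in> double_forms p q"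
  shows "(contraction B ^^ Suc p) \<omega> = (\<lambda>xs ys. 0)"
  using assms
proof (induction p arbitrary: q \<omega>)
  case 0
  then have "contraction B \<omega> = (\<lambda>xs ys. 0)" using contraction_eq_zero by blast
  then show ?case by simp
next
  case (Suc p)
  show ?case
  proof (cases q)
    case 0
    then have "contraction B \<omega> = (\<lambda>xs ys. 0)" using Suc.prems contraction_eq_zero by blast
    then show ?thesis unfolding contraction_pow_Suc[of "Suc p"] by (simp only: contraction_pow_zero)
  next
    case (Suc r)
    then have "contraction B \<omega> \<in> double_forms p r"
      using Suc.prems by (intro contraction_double_forms) simp
    then show ?thesis unfolding contraction_pow_Suc[of "Suc p"] by (rule Suc.IH)
  qed
qed

section \<open>Multiplication by the metric\<close>

locale orthonormal_basis =
  fixes B :: "'a::real_inner set"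
  assumes finite: "finite B" and span: "span B = UNIV" and orthogonal: "pairwise orthogonal B"
    and norm: "\<And>b. b \<in> B \<Longrightarrow> norm b = 1"
begin

text \<open>The difference of the two sides is orthogonal to \<open>B\<close>, hence to its span,
  hence to itself.\<close>

lemma expand: "(\<Sum>b\<in>B. inner b x *\<^sub>R b) = x"
proof -
  have "inner (x - (\<Sum>b\<in>B. inner b x *\<^sub>R b)) a = 0" if a: "a \<in> B" for a
  proof -
    have "(\<Sum>b\<in>B. inner b x * inner a b) = (\<Sum>b\<in>B. if b = a then inner a x else 0)"
      using orthogonal norm a
      by (intro sum.cong) (auto simp: pairwise_def orthogonal_def norm_eq_1)
    then have "inner a (x - (\<Sum>b\<in>B. inner b x *\<^sub>R b)) = 0"
      using finite a by (simp add: inner_diff_right inner_sum_right)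
    then show ?thesis by (subst inner_commute)
  qed
  then have "orthogonal (x - (\<Sum>b\<in>B. inner b x *\<^sub>R b)) y" for y
    using orthogonal_to_span[of y B] span by (auto simp: orthogonal_def)
  then show ?thesis by (metis orthogonal_self right_minus_eq)
qed

lemma alt_forms_expand:
  assumes "\<theta> \<in> alt_forms p"
  shows "(\<Sum>b\<in>B. inner b x * \<theta> (b # xs)) = \<theta> (x # xs)"
proof -
  have lin: "linear (\<lambda>v. \<theta> (v # xs))" using alt_forms_linear[OF assms, of "[]"] by simp
  have "\<theta> (x # xs) = \<theta> ((\<Sum>b\<in>B. inner b x *\<^sub>R b) # xs)" by (simp add: expand)
  also have "\<dots> = (\<Sum>b\<in>B. inner b x * \<theta> (b # xs))"
    by (simp add: linear_sum[OF lin] linear_cmul[OF lin])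
  finally show ?thesis by simp
qed

text \<open>
  Expand the multiplication by the metric along the first entries \<open>b\<close> of both lists. Pairing \<open>b\<close>
  with itself gives \<open>card B\<close> copies of \<open>\<omega>\<close>; pairing \<open>b\<close> with another entry moves that entry to
  the front and gives one copy of \<open>- \<omega>\<close>; the other terms form the product with the contraction.
\<close>

lemma contraction_metric_dmult:
  assumes \<omega>: "\<omega> \<in> double_forms p q"
  shows "contraction B (metric_form \<cdot>\<^sub>d \<omega>) xs ys =
    (metric_form \<cdot>\<^sub>d contraction B \<omega>) xs ys + (real (card B) - real p - real q) * \<omega> xs ys"
proof (cases "length xs = p \<and> length ys = q")
  \<comment> \<open>Off the bidegree of \<omega> every term on both sides is zero.\<close>
  case False
  have zero: "\<omega> us vs = 0" if "length us \<noteq> p \<or> length vs \<noteq> q" for us vs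
    using that alt_forms_length[OF double_forms_alt_left[OF \<omega>]]
      alt_forms_length[OF double_forms_alt_right[OF \<omega>]] by blast
  have zero': "\<omega> (b # del_nth i xs) (b # del_nth j ys) = 0"
    if "i < length xs" "j < length ys" for b i j
    by (rule zero) (use that False in \<open>simp, arith\<close>)
  have "(metric_form \<cdot>\<^sub>d \<omega>) (b # xs) (b # ys) = 0" for b
    unfolding metric_dmult using False by (intro sum.neutral ballI) (auto simp: zero)
  moreover have "(metric_form \<cdot>\<^sub>d contraction B \<omega>) xs ys = 0"
    unfolding metric_dmult contraction_def by (intro sum.neutral ballI) (simp add: zero')
  ultimately show ?thesis using False zero[of xs ys] by (simp add: contraction_def)
next
  case len: True
  have right: "(\<Sum>b\<in>B. \<Sum>j<q. (- 1) ^ Suc j * inner b (ys ! j) * \<omega> xs (b # del_nth j ys))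
      = - real q * \<omega> xs ys"
  proof -
    have "(\<Sum>b\<in>B. \<Sum>j<q. (- 1) ^ Suc j * inner b (ys ! j) * \<omega> xs (b # del_nth j ys))
        = (\<Sum>j<q. (- 1) ^ Suc j * (\<Sum>b\<in>B. inner b (ys ! j) * \<omega> xs (b # del_nth j ys)))"
      by (subst sum.swap) (simp add: sum_distrib_left mult.assoc)
    \<comment> \<open>Summing over \<open>b\<close> puts \<open>ys ! j\<close> in front; moving it
      back to its place gives the sign \<open>(- 1) ^ j\<close>, which against
      \<open>(- 1) ^ Suc j\<close> leaves -1.\<close>
    also have "\<dots> = (\<Sum>j<q. - \<omega> xs ys)"
      using len alt_forms_move_front[OF double_forms_alt_right[OF \<omega>], where xs = ys]
      by (intro sum.cong)
        (simp_all add: alt_forms_expand[OF double_forms_alt_right[OF \<omega>]] flip: power_mult_distrib)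
    finally show ?thesis by simp
  qed
  have left: "(\<Sum>b\<in>B. \<Sum>i<p. (- 1) ^ Suc i * inner (xs ! i) b * \<omega> (b # del_nth i xs) ys)
      = - real p * \<omega> xs ys"
  proof -
    have "(\<Sum>b\<in>B. \<Sum>i<p. (- 1) ^ Suc i * inner (xs ! i) b * \<omega> (b # del_nth i xs) ys)
        = (\<Sum>i<p. (- 1) ^ Suc i * (\<Sum>b\<in>B. inner b (xs ! i) * \<omega> (b # del_nth i xs) ys))"
      by (subst sum.swap) (simp add: sum_distrib_left mult.assoc inner_commute)
    also have "\<dots> = (\<Sum>i<p. - \<omega> xs ys)"
      using len alt_forms_move_front[OF double_forms_alt_left[OF \<omega>], where xs = xs]
      by (intro sum.cong)
        (simp_all add: alt_forms_expand[OF double_forms_alt_left[OF \<omega>]] flip: power_mult_distrib)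
    finally show ?thesis by simp
  qed
  have both: "(\<Sum>b\<in>B. \<Sum>i<p. \<Sum>j<q. (- 1) ^ (i + j) * inner (xs ! i) (ys ! j) *
      \<omega> (b # del_nth i xs) (b # del_nth j ys)) = (metric_form \<cdot>\<^sub>d contraction B \<omega>) xs ys"
    unfolding metric_dmult contraction_def sum_distrib_left
    using len by (subst sum.swap, subst (2) sum.swap) simp
  \<comment> \<open>Index 0 is split off from both sums of \<open>metric_dmult\<close>, giving four
    blocks; in the last one the two index shifts cancel in the sign.\<close>
  have "(metric_form \<cdot>\<^sub>d \<omega>) (b # xs) (b # ys) = \<omega> xs ys
      + (\<Sum>j<q. (- 1) ^ Suc j * inner b (ys ! j) * \<omega> xs (b # del_nth j ys))
      + (\<Sum>i<p. (- 1) ^ Suc i * inner (xs ! i) b * \<omega> (b # del_nth i xs) ys)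
      + (\<Sum>i<p. \<Sum>j<q. (- 1) ^ (i + j) * inner (xs ! i) (ys ! j) *
          \<omega> (b # del_nth i xs) (b # del_nth j ys))" if "b \<in> B" for b
    using len norm[OF that]
    by (simp add: metric_dmult sum.lessThan_Suc_shift sum.distrib norm_eq_1
        del: sum.lessThan_Suc)
  then have "contraction B (metric_form \<cdot>\<^sub>d \<omega>) xs ys = (\<Sum>b\<in>B. \<omega> xs ys
      + (\<Sum>j<q. (- 1) ^ Suc j * inner b (ys ! j) * \<omega> xs (b # del_nth j ys))
      + (\<Sum>i<p. (- 1) ^ Suc i * inner (xs ! i) b * \<omega> (b # del_nth i xs) ys)
      + (\<Sum>i<p. \<Sum>j<q. (- 1) ^ (i + j) * inner (xs ! i) (ys ! j) *
          \<omega> (b # del_nth i xs) (b # del_nth j ys)))"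
    unfolding contraction_def by (rule sum.cong[OF refl])
  then show ?thesis
    unfolding sum.distrib left right both by (simp add: algebra_simps)
qed

lemma metric_dmult_double_forms:
  fixes \<omega> :: "'a list \<Rightarrow> 'a list \<Rightarrow> real"
  assumes "\<omega> \<in> double_forms p q"
  shows "metric_form \<cdot>\<^sub>d \<omega> \<in> double_forms (Suc p) (Suc q)"
  using dmult_double_forms[OF metric_double_form[OF finite span orthogonal norm] assms]
  by (simp only: plus_1_eq_Suc)

text \<open>
  The zero form has every weight, so that no case distinction is needed when a contraction leaves
  the range of degrees.
\<close>

definition has_weight :: "real \<Rightarrow> ('a list \<Rightarrow> 'a list \<Rightarrow> real) \<Rightarrow> bool" where
  "has_weight h \<omega> \<longleftrightarrow> \<omega> = (\<lambda>xs ys. 0) \<or>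
     (\<exists>p q. \<omega> \<in> double_forms p q \<and> h = real (card B) - real p - real q)"

lemma has_weight_commutator:
  assumes "has_weight h \<omega>"
  shows "contraction B (metric_form \<cdot>\<^sub>d \<omega>) =
    (\<lambda>xs ys. 1 * (metric_form \<cdot>\<^sub>d contraction B \<omega>) xs ys + h * \<omega> xs ys)"
proof (cases "\<omega> = (\<lambda>xs ys. 0)")
  case True
  show ?thesis unfolding True contraction_zero metric_dmult_zero by simp
next
  case False
  then obtain p q where *: "\<omega> \<in> double_forms p q" "h = real (card B) - real p - real q"
    using assms unfolding has_weight_def by blast
  show ?thesis unfolding *(2) contraction_metric_dmult[OF *(1), abs_def] by simp
qed

text \<open>Both degrees drop by one. A nonzero contraction forces them to be positive, so the drop
  is a genuine one.\<close>

lemma has_weight_contraction: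
  assumes "has_weight h \<omega>"
  shows "has_weight (h + 2) (contraction B \<omega>)"
proof (cases "contraction B \<omega> = (\<lambda>xs ys. 0)")
  case False
  then obtain p q where *: "\<omega> \<in> double_forms p q" "h = real (card B) - real p - real q"
    using assms contraction_zero unfolding has_weight_def by blast
  then have "p \<noteq> 0 \<and> q \<noteq> 0" using contraction_eq_zero[of \<omega> p q B] False by metis
  then obtain p' q' where "p = Suc p'" "q = Suc q'" by (meson not0_implies_Suc)
  then show ?thesis
    using *(1) contraction_double_forms[of \<omega> p' q' B] unfolding has_weight_def *(2)
    by (intro disjI2 exI[of _ p'] exI[of _ q']) simp
qed (simp add: has_weight_def)

text \<open>Commuting the contractions past the metric one at a time collects the weights
  \<open>h\<close>, \<open>h + 2\<close>, ..., \<open>h + 2 * j\<close>, whose sum is the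
  coefficient.\<close>

lemma contraction_pow_metric_dmult:
  assumes "has_weight h \<omega>"
  shows "(contraction B ^^ Suc j) (metric_form \<cdot>\<^sub>d \<omega>) =
    (\<lambda>xs ys. (metric_form \<cdot>\<^sub>d (contraction B ^^ Suc j) \<omega>) xs ys
       + real (Suc j) * (h + real j) * (contraction B ^^ j) \<omega> xs ys)"
  using assms
proof (induction j arbitrary: h \<omega>)
  case 0
  then show ?case by (simp add: has_weight_commutator)
next
  case (Suc j)
  let ?C = "contraction B"
  have "(?C ^^ Suc (Suc j)) (metric_form \<cdot>\<^sub>d \<omega>) = (?C ^^ Suc j) (?C (metric_form \<cdot>\<^sub>d \<omega>))"
    by (rule contraction_pow_Suc)
  also have "\<dots> = (\<lambda>xs ys. 1 * (?C ^^ Suc j) (metric_form \<cdot>\<^sub>d ?C \<omega>) xs ys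
      + h * (?C ^^ Suc j) \<omega> xs ys)"
    unfolding has_weight_commutator[OF Suc.prems] by (rule contraction_pow_linear)
  \<comment> \<open>The induction hypothesis is used for the contracted form, of weight
    \<open>h + 2\<close>; the coefficients combine by (j + 1)(h + 2 + j) + h = (j + 2)(h + j +
    1).\<close>
  also have "\<dots> = (\<lambda>xs ys. (metric_form \<cdot>\<^sub>d (?C ^^ Suc j) (?C \<omega>)) xs ys
       + real (Suc j) * (h + 2 + real j) * (?C ^^ j) (?C \<omega>) xs ys + h * (?C ^^ Suc j) \<omega> xs ys)"
    unfolding Suc.IH[OF has_weight_contraction[OF Suc.prems]] by simp
  also have "(?C ^^ Suc j) (?C \<omega>) = (?C ^^ Suc (Suc j)) \<omega>"
    by (rule contraction_pow_Suc[symmetric])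
  also have "(?C ^^ j) (?C \<omega>) = (?C ^^ Suc j) \<omega>"
    by (rule contraction_pow_Suc[symmetric])
  finally show ?case by (simp add: algebra_simps)
qed

section \<open>Injectivity for p + q < n\<close>

lemma metric_dmult_kernel:
  fixes \<omega> :: "'a list \<Rightarrow> 'a list \<Rightarrow> real"
  assumes \<omega>: "\<omega> \<in> double_forms p q" and less: "p + q < card B"
    and zero: "metric_form \<cdot>\<^sub>d \<omega> = (\<lambda>xs ys. 0)"
  shows "\<omega> = (\<lambda>xs ys. 0)"
proof -
  define h where "h = real (card B) - real p - real q"
  have h: "has_weight h \<omega>" "h > 0" using \<omega> less by (auto simp: has_weight_def h_def)
  have step: "(contraction B ^^ j) \<omega> = (\<lambda>xs ys. 0)"
    if "(contraction B ^^ Suc j) \<omega> = (\<lambda>xs ys. 0)" for j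
  proof (intro ext)
    fix xs ys
    \<comment> \<open>Both terms of the commutator formula that contain the metric vanish, so only
      the scalar multiple is left.\<close>
    have "real (Suc j) * (h + real j) * (contraction B ^^ j) \<omega> xs ys = 0"
      using fun_cong[OF fun_cong[OF contraction_pow_metric_dmult[OF h(1), of j]], of xs ys]
      unfolding that zero contraction_pow_zero metric_dmult_zero by simp
    then show "(contraction B ^^ j) \<omega> xs ys = 0" using h(2) by auto
  qed
  have "(contraction B ^^ j) \<omega> = (\<lambda>xs ys. 0) \<Longrightarrow> \<omega> = (\<lambda>xs ys. 0)" for j
  proof (induction j)
    case (Suc j)
    then show ?case using step by blast
  qed simp
  then show ?thesis using contraction_pow_eq_zero[OF \<omega>] by blast
qed

lemma metric_dmult_inj:
  assumes "p + q < card B"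
  shows "inj_on (\<lambda>\<omega>. metric_form \<cdot>\<^sub>d \<omega>) (double_forms p q :: ('a list \<Rightarrow> 'a list \<Rightarrow> real) set)"
proof (rule inj_onI)
  fix \<omega> \<eta> :: "'a list \<Rightarrow> 'a list \<Rightarrow> real"
  assume *: "\<omega> \<in> double_forms p q" "\<eta> \<in> double_forms p q"
    "metric_form \<cdot>\<^sub>d \<omega> = metric_form \<cdot>\<^sub>d \<eta>"
  have "(\<lambda>xs ys. 1 * \<omega> xs ys + (- 1) * \<eta> xs ys) = (\<lambda>xs ys. 0)"
  proof (rule metric_dmult_kernel[OF _ assms])
    show "(\<lambda>xs ys. 1 * \<omega> xs ys + (- 1) * \<eta> xs ys) \<in> double_forms p q"
      using * by (intro double_forms_add double_forms_scale)
    show "metric_form \<cdot>\<^sub>d (\<lambda>xs ys. 1 * \<omega> xs ys + (- 1) * \<eta> xs ys) = (\<lambda>xs ys. 0)"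
      unfolding metric_dmult_linear *(3) by simp
  qed
  then show "\<omega> = \<eta>" by (simp add: fun_eq_iff)
qed

section \<open>Surjectivity for p + q + 1 \<ge> n\<close>

lemma card_eq_dim: "card B = dim (UNIV :: 'a set)"
proof -
  have "0 \<notin> B" using norm by force
  then have "independent B" using pairwise_orthogonal_independent orthogonal by blast
  then show ?thesis using dim_eq_card_independent span by (metis dim_span)
qed

lemma metric_dmult_pow_double_forms:
  fixes \<omega> :: "'a list \<Rightarrow> 'a list \<Rightarrow> real"
  assumes "\<omega> \<in> double_forms p q"
  shows "((\<lambda>\<omega>. metric_form \<cdot>\<^sub>d \<omega>) ^^ j) \<omega> \<in> double_forms (p + j) (q + j)"
  using assms by (induction j) (auto intro: metric_dmult_double_forms)

lemma metric_dmult_surj: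
  assumes ge: "p + q + 1 \<ge> card B"
  shows "(\<lambda>\<omega>. metric_form \<cdot>\<^sub>d \<omega>) ` (double_forms p q :: ('a list \<Rightarrow> 'a list \<Rightarrow> real) set)
    = double_forms (p + 1) (q + 1)"
proof
  let ?U = "\<lambda>\<omega>::'a list \<Rightarrow> 'a list \<Rightarrow> real. metric_form \<cdot>\<^sub>d \<omega>" and ?C = "contraction B"
  let ?R = "?U ` double_forms p q"
  show "?R \<subseteq> double_forms (p + 1) (q + 1)"
    using metric_dmult_double_forms by auto
  show "double_forms (p + 1) (q + 1) \<subseteq> ?R"
  proof
    fix \<eta> :: "'a list \<Rightarrow> 'a list \<Rightarrow> real"
    assume \<eta>: "\<eta> \<in> double_forms (p + 1) (q + 1)"
    have pow: "(?U ^^ j) \<eta> \<in> double_forms (p + 1 + j) (q + 1 + j)" for j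
      by (rule metric_dmult_pow_double_forms[OF \<eta>])
    have step: "(?C ^^ j) ((?U ^^ j) \<eta>) \<in> ?R" if R: "(?C ^^ Suc j) ((?U ^^ Suc j) \<eta>) \<in> ?R" for j
    proof -
      define h where "h = real (card B) - real (p + 1 + j) - real (q + 1 + j)"
      define c where "c = real (Suc j) * (h + real j)"
      have "has_weight h ((?U ^^ j) \<eta>)" using pow[of j] unfolding has_weight_def h_def by blast
      note comm = contraction_pow_metric_dmult[OF this, of j, folded c_def]
      \<comment> \<open>Here h + j = n - p - q - 2 - j, and n - p - q is at most 1.\<close>
      have "h + real j < 0" using ge by (simp add: h_def)
      then have c: "c \<noteq> 0" by (simp add: c_def)
      define \<zeta> where "\<zeta> = (?C ^^ Suc j) ((?U ^^ j) \<eta>)"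
      have \<zeta>: "\<zeta> \<in> double_forms p q"
        unfolding \<zeta>_def using pow[of j] by (intro contraction_pow_double_forms) simp
      obtain \<xi> where \<xi>: "\<xi> \<in> double_forms p q" "(?C ^^ Suc j) ((?U ^^ Suc j) \<eta>) = ?U \<xi>"
        using R by blast
      have eq: "(metric_form \<cdot>\<^sub>d \<xi>) xs ys
          = (metric_form \<cdot>\<^sub>d \<zeta>) xs ys + c * (?C ^^ j) ((?U ^^ j) \<eta>) xs ys" for xs ys
        using fun_cong[OF fun_cong[OF comm]] \<xi>(2) unfolding \<zeta>_def by simp
      \<comment> \<open>The commutator formula is solved for the term with the nonzero coefficient
        \<open>c\<close>; the other two terms are products with the metric.\<close>
      have "(?C ^^ j) ((?U ^^ j) \<eta>) =
          metric_form \<cdot>\<^sub>d (\<lambda>xs ys. (1 / c) * \<xi> xs ys + (- 1 / c) * \<zeta> xs ys)"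
        unfolding metric_dmult_linear using c by (intro ext) (simp add: eq field_simps)
      moreover have "(\<lambda>xs ys. (1 / c) * \<xi> xs ys + (- 1 / c) * \<zeta> xs ys) \<in> double_forms p q"
        using \<xi>(1) \<zeta> by (intro double_forms_add double_forms_scale)
      ultimately show ?thesis by blast
    qed
    \<comment> \<open>The descent starts here: the degree p + 1 + n exceeds the dimension.\<close>
    have "(?U ^^ card B) \<eta> = (\<lambda>xs ys. 0)"
      using pow[of "card B"] double_forms_eq_zero[OF finite span] card_eq_dim by simp
    then have "(?C ^^ card B) ((?U ^^ card B) \<eta>) = ?U (\<lambda>xs ys. 0)"
      by (simp add: contraction_pow_zero metric_dmult_zero)
    then have "(?C ^^ card B) ((?U ^^ card B) \<eta>) \<in> ?R"
      using double_forms_zero by blast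
    moreover have "(?C ^^ j) ((?U ^^ j) \<eta>) \<in> ?R \<Longrightarrow> \<eta> \<in> ?R" for j
    proof (induction j)
      case (Suc j)
      then show ?case using step by blast
    qed simp
    ultimately show "\<eta> \<in> ?R" by blast
  qed
qed

section \<open>Failure of injectivity and surjectivity in the remaining degrees\<close>

lemma wedge_list_self_basis: "distinct bs \<Longrightarrow> set bs \<subseteq> B \<Longrightarrow> wedge_list bs bs = 1"
  using orthogonal norm by (intro wedge_list_self) (auto intro: pairwise_subset)

lemma wedge_list_eq_zero_basis:
  assumes "b \<in> set bs" "b \<in> B" "set xs \<subseteq> B" "b \<notin> set xs"
  shows "wedge_list bs xs = 0"
proof (rule wedge_list_eq_zero[OF assms(1)])
  fix x assume "x \<in> set xs"
  then show "inner b x = 0"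
    using assms orthogonal unfolding pairwise_def orthogonal_def by (metis subsetD)
qed

text \<open>On distinct basis lists a term survives the inner product only if the deleted entries
  are the same vector \<open>b\<close>. Then \<open>b\<close> is missing from both remaining lists,
  but occurs in \<open>us\<close> or \<open>vs\<close>, so one factor vanishes.\<close>

lemma metric_dmult_wedge_lists_zero:
  assumes us: "set us \<subseteq> B" and vs: "set vs \<subseteq> B" and cover: "B \<subseteq> set us \<union> set vs"
  shows "metric_form \<cdot>\<^sub>d (wedge_list us \<otimes>\<^sub>f wedge_list vs) = (\<lambda>xs ys. 0)"
proof (intro ext)
  let ?\<omega> = "wedge_list us \<otimes>\<^sub>f wedge_list vs"
  have g: "metric_form \<cdot>\<^sub>d ?\<omega> \<in> double_forms (Suc (length us)) (Suc (length vs))"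
    by (intro metric_dmult_double_forms tensor_double_forms wedge_list_alt_form)
  have basis: "(metric_form \<cdot>\<^sub>d ?\<omega>) xs ys = 0" if B: "set xs \<subseteq> B" "set ys \<subseteq> B" for xs ys
  proof (cases "distinct xs \<and> distinct ys")
    case False
    then show ?thesis
      using alt_forms_not_distinct[OF double_forms_alt_left[OF g]]
        alt_forms_not_distinct[OF double_forms_alt_right[OF g]] by blast
  next
    case True
    have "inner (xs ! i) (ys ! j) * ?\<omega> (del_nth i xs) (del_nth j ys) = 0"
      if ij: "i < length xs" "j < length ys" for i j
    proof (cases "xs ! i = ys ! j")
      case False
      moreover have "xs ! i \<in> B" "ys ! j \<in> B" using B ij nth_mem by blast+
      ultimately have "inner (xs ! i) (ys ! j) = 0"
        using orthogonal unfolding pairwise_def orthogonal_def by blast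
      then show ?thesis by simp
    next
      case eq: True
      have b: "xs ! i \<in> B" using B ij nth_mem by blast
      have "xs ! i \<notin> set (del_nth i xs)" "xs ! i \<notin> set (del_nth j ys)"
        using True ij nth_notin_del_nth[of xs i] nth_notin_del_nth[of ys j] eq by simp_all
      moreover have "set (del_nth i xs) \<subseteq> B" "set (del_nth j ys) \<subseteq> B"
        using B set_del_nth ij by blast+
      ultimately have "wedge_list us (del_nth i xs) = 0 \<or> wedge_list vs (del_nth j ys) = 0"
        using b cover wedge_list_eq_zero_basis by blast
      then show ?thesis by (auto simp: tensor_def)
    qed
    then show ?thesis
      unfolding metric_dmult by (intro sum.neutral ballI) (auto simp: mult.assoc)
  qed
  fix xs ys
  \<comment> \<open>The vanishing extends from basis lists to all lists, first on the left and then
    on the right.\<close>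
  have "(metric_form \<cdot>\<^sub>d ?\<omega>) xs ys = 0" if "set ys \<subseteq> B" for ys
    using alt_forms_eq_zero_on_basis[OF double_forms_alt_left[OF g] span] basis that by blast
  then show "(metric_form \<cdot>\<^sub>d ?\<omega>) xs ys = 0"
    using alt_forms_eq_zero_on_basis[OF double_forms_alt_right[OF g] span] by blast
qed

lemma metric_dmult_not_inj:
  assumes "p + q \<ge> card B" "p \<le> card B" "q \<le> card B"
  shows "\<not> inj_on (\<lambda>\<omega>. metric_form \<cdot>\<^sub>d \<omega>) (double_forms p q :: ('a list \<Rightarrow> 'a list \<Rightarrow> real) set)"
proof
  assume inj: "inj_on (\<lambda>\<omega>. metric_form \<cdot>\<^sub>d \<omega>)
    (double_forms p q :: ('a list \<Rightarrow> 'a list \<Rightarrow> real) set)"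
  obtain bs where bs: "set bs = B" "distinct bs"
    using finite_distinct_list[OF finite] by blast
  then have len: "length bs = card B" using distinct_card by metis
  \<comment> \<open>The first \<open>p\<close> and the last \<open>q\<close> basis vectors cover
    \<open>B\<close> because p + q \<ge> n; \<open>q \<le> card B\<close> keeps the subtraction from
    truncating.\<close>
  define us where "us = take p bs"
  define vs where "vs = drop (card B - q) bs"
  let ?\<omega> = "wedge_list us \<otimes>\<^sub>f wedge_list vs"
  have sub: "set us \<subseteq> B" "set vs \<subseteq> B"
    using bs(1) set_take_subset set_drop_subset by (fastforce simp: us_def vs_def)+
  have "set (drop p bs) \<subseteq> set vs"
    unfolding vs_def using assms by (intro set_drop_subset_set_drop) simp
  moreover have "B = set us \<union> set (drop p bs)"
    unfolding us_def bs(1)[symmetric] by (metis append_take_drop_id set_append)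
  ultimately have "B \<subseteq> set us \<union> set vs" by blast
  then have zero: "metric_form \<cdot>\<^sub>d ?\<omega> = metric_form \<cdot>\<^sub>d (\<lambda>xs ys. 0)"
    unfolding metric_dmult_zero by (rule metric_dmult_wedge_lists_zero[OF sub])
  have "length us = p" "length vs = q" using len assms by (auto simp: us_def vs_def)
  then have "?\<omega> \<in> double_forms p q"
    using tensor_double_forms[OF wedge_list_alt_form[of us] wedge_list_alt_form[of vs]] by simp
  then have "?\<omega> = (\<lambda>xs ys. 0)"
    by (rule inj_onD[OF inj zero _ double_forms_zero])
  moreover have "?\<omega> us vs = 1"
    using sub bs(2) by (simp add: tensor_def wedge_list_self_basis us_def vs_def)
  ultimately show False by simp
qed

text \<open>Any product with the metric vanishes at a pair of mutually orthogonal lists, whereas the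
  form built from two disjoint lists of basis vectors takes the value 1 there.\<close>

lemma metric_dmult_not_surj:
  assumes "p + q + 2 \<le> card B"
  shows "(\<lambda>\<omega>. metric_form \<cdot>\<^sub>d \<omega>) ` (double_forms p q :: ('a list \<Rightarrow> 'a list \<Rightarrow> real) set)
    \<noteq> double_forms (p + 1) (q + 1)"
proof
  assume surj: "(\<lambda>\<omega>. metric_form \<cdot>\<^sub>d \<omega>) ` (double_forms p q :: ('a list \<Rightarrow> 'a list \<Rightarrow> real) set)
    = double_forms (p + 1) (q + 1)"
  obtain bs where bs: "set bs = B" "distinct bs"
    using finite_distinct_list[OF finite] by blast
  then have len: "length bs = card B" using distinct_card by metis
  \<comment> \<open>The first p + 1 and the last q + 1 basis vectors are disjoint because p + q + 2
    \<le> n.\<close>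
  define us where "us = take (p + 1) bs"
  define vs where "vs = drop (card B - (q + 1)) bs"
  let ?\<omega> = "wedge_list us \<otimes>\<^sub>f wedge_list vs"
  have sub: "set us \<subseteq> B" "set vs \<subseteq> B"
    using bs(1) set_take_subset set_drop_subset by (fastforce simp: us_def vs_def)+
  have disj: "set us \<inter> set vs = {}"
    unfolding us_def vs_def using assms bs(2) by (intro set_take_disj_set_drop_if_distinct) auto
  have "length us = p + 1" "length vs = q + 1" using len assms by (auto simp: us_def vs_def)
  then have "?\<omega> \<in> double_forms (p + 1) (q + 1)"
    using tensor_double_forms[OF wedge_list_alt_form[of us] wedge_list_alt_form[of vs]] by simp
  then obtain \<omega> where \<omega>: "?\<omega> = metric_form \<cdot>\<^sub>d \<omega>" using surj by blast
  have "inner (us ! i) (vs ! j) = 0" if "i < length us" "j < length vs" for i j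
  proof -
    have "us ! i \<in> set us" "vs ! j \<in> set vs" using that by auto
    then have "us ! i \<in> B" "vs ! j \<in> B" "us ! i \<noteq> vs ! j" using disj sub by auto
    then show ?thesis
      using orthogonal unfolding pairwise_def orthogonal_def by blast
  qed
  then have "(metric_form \<cdot>\<^sub>d \<omega>) us vs = 0"
    unfolding metric_dmult by (intro sum.neutral ballI) auto
  moreover have "?\<omega> us vs = 1"
    using sub bs(2) by (simp add: tensor_def wedge_list_self_basis us_def vs_def)
  ultimately show False using \<omega> by simp
qed

end

text \<open>An orthogonal spanning set is stripped of the zero vector and normalised.\<close>

lemma orthonormal_basis_exists:
  assumes "finite A" "span A = (UNIV :: 'a::real_inner set)"
  shows "\<exists>B::'a set. orthonormal_basis B"
proof -
  obtain C where C: "finite C" "span C = (UNIV :: 'a set)" "pairwise orthogonal C"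
    using basis_orthogonal[OF assms(1)] assms(2) by auto
  let ?f = "\<lambda>c::'a. (1 / norm c) *\<^sub>R c"
  let ?B = "?f ` (C - {0})"
  have "orthonormal_basis ?B"
  proof
    have "c \<in> span ?B" if "c \<in> C" for c
    proof (cases "c = 0")
      case False
      then have "norm c *\<^sub>R ?f c \<in> span ?B" using that by (intro span_scale span_base) auto
      then show ?thesis using False by simp
    qed (simp add: span_zero)
    then have "span C \<subseteq> span ?B" by (intro span_minimal) auto
    then show "span ?B = UNIV" using C(2) by auto
    show "pairwise orthogonal ?B"
      using C(3) by (auto simp: pairwise_def orthogonal_def)
  qed (use C(1) in \<open>auto split: if_splits\<close>)
  then show ?thesis by blast
qed

text \<open>The degree conditions are stated over the integers so that n - 1 is -1 for n = 0;
  truncated subtraction would make (1) and (2) false there.\<close>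

theorem proposition2p5:
  fixes n p q :: nat
  assumes "\<exists>B. finite B \<and> span B = (UNIV :: 'a::real_inner set)"
    and "dim (UNIV :: 'a set) = n"
    and "p \<le> n" and "q \<le> n"
  shows "(inj_on (\<lambda>\<omega>. metric_form \<cdot>\<^sub>d \<omega>) (double_forms p q :: ('a list \<Rightarrow> 'a list \<Rightarrow> real) set)
            \<longleftrightarrow> int p + int q \<le> int n - 1) \<and>
         (bij_betw (\<lambda>\<omega>. metric_form \<cdot>\<^sub>d \<omega>)
              (double_forms p q :: ('a list \<Rightarrow> 'a list \<Rightarrow> real) set) (double_forms (p + 1) (q + 1))
            \<longleftrightarrow> int p + int q = int n - 1) \<and>
         ((\<lambda>\<omega>. metric_form \<cdot>\<^sub>d \<omega>) ` (double_forms p q :: ('a list \<Rightarrow> 'a list \<Rightarrow> real) set)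
              = double_forms (p + 1) (q + 1)
            \<longleftrightarrow> int p + int q \<ge> int n - 1)"
proof -
  obtain B :: "'a set" where "orthonormal_basis B"
    using assms(1) orthonormal_basis_exists by blast
  then interpret orthonormal_basis B .
  have n: "card B = n" using card_eq_dim assms(2) by simp
  let ?D = "double_forms p q :: ('a list \<Rightarrow> 'a list \<Rightarrow> real) set"
  have inj: "inj_on (\<lambda>\<omega>. metric_form \<cdot>\<^sub>d \<omega>) ?D \<longleftrightarrow> int p + int q \<le> int n - 1"
    using metric_dmult_inj[of p q] metric_dmult_not_inj[of p q] assms(3,4) n
    by (cases "p + q < n") auto
  have surj: "(\<lambda>\<omega>. metric_form \<cdot>\<^sub>d \<omega>) ` ?D = double_forms (p + 1) (q + 1)
      \<longleftrightarrow> int p + int q \<ge> int n - 1"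
  proof (cases "p + q + 1 \<ge> n")
    case True
    then show ?thesis using metric_dmult_surj[of p q] n by simp
  next
    case False
    then show ?thesis using metric_dmult_not_surj[of p q] n by simp
  qed
  show ?thesis
    using inj surj unfolding bij_betw_def by auto
qed

end
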